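(* Let $N,M\ge 1$ be integers, $\sigma>0$ and $|\rho|<1$ real. Let $x_{0n},y_{0n}$ ($1\le n\le N$) and $x_{mn},y_{mn}$ ($2\le m\le M$, $1\le n\le N$) be mutually independent real Gaussian random variables with mean $0$ and variance $1/2$. Define $h_{1n}=\sigma x_{0n}+j\sigma y_{0n}$ and, for $2\le m\le M$, $h_{mn}=\sigma(\sqrt{1-\rho^2}\,x_{mn}+\rho x_{0n})+j\sigma(\sqrt{1-\rho^2}\,y_{mn}+\rho y_{0n})$, where $j$ is the imaginary unit. Let $X_m=\sum_{n=1}^N|h_{mn}|^2$, $X_{\rm FAS}=\max\{X_1,\dots,X_M\}$ and $P_{\rm out}(\gamma_{th})=\Pr(X_{\rm FAS}<\gamma_{th})$. Then for every $\gamma_{th}>0$, $$P_{\rm out}(\gamma_{th})\ge\frac{1}{(N-1)!}\,\gamma\!\left(N,\frac{\gamma_{th}}{\sigma^2}\right)\left(1-Q_N\!\left(\sqrt{\frac{2\rho^2\gamma_{th}}{\sigma^2(1-\rho^2)}},\sqrt{\frac{2\gamma_{th}}{\sigma^2(1-\rho^2)}}\right)\right)^{M-1}.$$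
   Context: $\gamma(N,x)=\int_0^x s^{N-1}e^{-s}\,ds$ is the lower incomplete gamma function. For an integer $\nu\ge1$, $Q_\nu$ is the generalized Marcum $Q$-function: for $a>0$, $b\ge0$, $Q_\nu(a,b)=\int_b^\infty x\left(\frac{x}{a}\right)^{\nu-1}e^{-\frac{x^2+a^2}{2}}I_{\nu-1}(ax)\,dx$, where $I_{\nu-1}$ is the modified Bessel function of the first kind, and $Q_\nu(0,b)$ is the limit as $a\to0^+$, i.e. $Q_\nu(0,b)=\frac{1}{(\nu-1)!}\int_{b^2/2}^\infty s^{\nu-1}e^{-s}ds$. *)

theory Defs
  imports "HOL-Probability.Probability"
begin

definition lower_inc_gamma :: "nat \<Rightarrow> real \<Rightarrow> real" where
  "lower_inc_gamma N x = (\<integral>s\<in>{0..x}. s ^ (N - 1) * exp (- s) \<partial>lborel)"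

text \<open>Modified Bessel function of the first kind, integer order \<open>n \<ge> 0\<close>, by its
  (everywhere convergent) power series.\<close>

definition bessel_I :: "nat \<Rightarrow> real \<Rightarrow> real" where
  "bessel_I n x = (\<Sum>k. (x / 2) ^ (2 * k + n) / (fact k * fact (k + n)))"

text \<open>Generalized Marcum \<open>Q\<close>-function, meant for \<open>\<nu> \<ge> 1\<close>, \<open>a \<ge> 0\<close>, \<open>b \<ge> 0\<close>. The integrand
  is undefined at \<open>a = 0\<close>; the value there is the limit for \<open>a\<close> tending to \<open>0\<close> from the right.\<close>

definition marcum_Q :: "nat \<Rightarrow> real \<Rightarrow> real \<Rightarrow> real" where
  "marcum_Q \<nu> a b =
    (if a = 0
     then 1 / fact (\<nu> - 1) * (\<integral>s\<in>{b\<^sup>2 / 2..}. s ^ (\<nu> - 1) * exp (- s) \<partial>lborel)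
     else \<integral>x\<in>{b..}. x * (x / a) ^ (\<nu> - 1) * exp (- (x\<^sup>2 + a\<^sup>2) / 2) * bessel_I (\<nu> - 1) (a * x) \<partial>lborel)"

text \<open>In the following, \<open>x m n\<close> and \<open>y m n\<close> are the real Gaussian components; the row \<open>m = 0\<close> is the
  common component shared by all ports, and the row \<open>m = 1\<close> is never used.\<close>

definition channel ::
  "real \<Rightarrow> real \<Rightarrow> (nat \<Rightarrow> nat \<Rightarrow> 'a \<Rightarrow> real) \<Rightarrow> (nat \<Rightarrow> nat \<Rightarrow> 'a \<Rightarrow> real) \<Rightarrow> nat \<Rightarrow> nat \<Rightarrow> 'a \<Rightarrow> complex" where
  "channel \<sigma> \<rho> x y m n \<omega> =
    (if m = 1
     then complex_of_real (\<sigma> * x 0 n \<omega>) + \<i> * complex_of_real (\<sigma> * y 0 n \<omega>)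
     else complex_of_real (\<sigma> * (sqrt (1 - \<rho>\<^sup>2) * x m n \<omega> + \<rho> * x 0 n \<omega>))
        + \<i> * complex_of_real (\<sigma> * (sqrt (1 - \<rho>\<^sup>2) * y m n \<omega> + \<rho> * y 0 n \<omega>)))"

definition port_gain ::
  "nat \<Rightarrow> real \<Rightarrow> real \<Rightarrow> (nat \<Rightarrow> nat \<Rightarrow> 'a \<Rightarrow> real) \<Rightarrow> (nat \<Rightarrow> nat \<Rightarrow> 'a \<Rightarrow> real) \<Rightarrow> nat \<Rightarrow> 'a \<Rightarrow> real" where
  "port_gain N \<sigma> \<rho> x y m \<omega> = (\<Sum>n=1..N. (cmod (channel \<sigma> \<rho> x y m n \<omega>))\<^sup>2)"

definition X_FAS ::
  "nat \<Rightarrow> nat \<Rightarrow> real \<Rightarrow> real \<Rightarrow> (nat \<Rightarrow> nat \<Rightarrow> 'a \<Rightarrow> real) \<Rightarrow> (nat \<Rightarrow> nat \<Rightarrow> 'a \<Rightarrow> real) \<Rightarrow> 'a \<Rightarrow> real" where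
  "X_FAS N M \<sigma> \<rho> x y \<omega> = Max ((\<lambda>m. port_gain N \<sigma> \<rho> x y m \<omega>) ` {1..M})"

definition P_out ::
  "'a measure \<Rightarrow> nat \<Rightarrow> nat \<Rightarrow> real \<Rightarrow> real \<Rightarrow> (nat \<Rightarrow> nat \<Rightarrow> 'a \<Rightarrow> real) \<Rightarrow> (nat \<Rightarrow> nat \<Rightarrow> 'a \<Rightarrow> real) \<Rightarrow> real \<Rightarrow> real" where
  "P_out P N M \<sigma> \<rho> x y t = measure P {\<omega> \<in> space P. X_FAS N M \<sigma> \<rho> x y \<omega> < t}"

end

theory Submission
  imports Defs
begin

text \<open>Let \<open>U\<close> be the squared norm of the common Gaussian vector; then \<open>X\<^sub>1 = \<sigma>\<^sup>2 U\<close> with \<open>U\<close>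
  Gamma-distributed of shape \<open>N\<close>. Given the common vector, the gains \<open>X\<^sub>2, \<dots>, X\<^sub>M\<close> are independent
  and identically distributed noncentral chi-squares, so the outage probability is the integral of
  \<open>F(U) ^ (M - 1)\<close> over the event \<open>U < \<gamma>th / \<sigma>\<^sup>2\<close>, where \<open>F(U)\<close> is one minus a Marcum function. The
  noncentral chi-square law is a Poisson mixture of Gamma laws of increasing shape, hence \<open>F\<close> is
  decreasing in \<open>U\<close> and may be replaced by its value at the boundary \<open>U = \<gamma>th / \<sigma>\<^sup>2\<close>.\<close>

section \<open>Gamma densities and their Poisson mixtures\<close>

text \<open>The shape is real because a single squared Gaussian component has shape
  \<open>1 / 2\<close>; the rate is \<open>1\<close> because components of variance
  \<open>1 / 2\<close> have densities proportional to \<open>exp (- z\<^sup>2)\<close>.\<close>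

definition gamma_density :: "real \<Rightarrow> real \<Rightarrow> real" where
  "gamma_density a x = (if x > 0 then x powr (a - 1) * exp (- x) / Gamma a else 0)"

definition poisson_weight :: "real \<Rightarrow> nat \<Rightarrow> real" where
  "poisson_weight l k = l ^ k / fact k * exp (- l)"

text \<open>The law of \<open>|z + v|\<^sup>2\<close> for a Gaussian vector \<open>z\<close> of dimension \<open>2 a\<close> with components of
  variance \<open>1/2\<close>, where \<open>l = |v|\<^sup>2\<close>. Values in \<open>ennreal\<close> spare all summability conditions.\<close>

definition nc_gamma_density :: "real \<Rightarrow> real \<Rightarrow> real \<Rightarrow> ennreal" where
  "nc_gamma_density a l x =
    (\<Sum>k. ennreal (poisson_weight l k) * ennreal (gamma_density (a + real k) x))"

lemma gamma_density_nonneg: "a > 0 \<Longrightarrow> 0 \<le> gamma_density a x"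
  by (simp add: gamma_density_def Gamma_real_pos less_imp_le)

lemma gamma_density_measurable [measurable]: "gamma_density a \<in> borel_measurable borel"
  unfolding gamma_density_def by measurable

lemma nc_gamma_density_measurable [measurable]: "nc_gamma_density a l \<in> borel_measurable borel"
  unfolding nc_gamma_density_def by measurable

lemma poisson_weight_nonneg: "l \<ge> 0 \<Longrightarrow> 0 \<le> poisson_weight l k"
  by (simp add: poisson_weight_def)

lemma poisson_weight_sums: "poisson_weight l sums 1"
proof -
  have "(\<lambda>k. l ^ k / fact k * exp (- l)) sums (exp l * exp (- l))"
    using exp_converges[of l] by (intro sums_mult2) (simp add: field_simps)
  then show ?thesis by (simp add: poisson_weight_def[abs_def] flip: exp_add)
qed

section \<open>Convolution of Gamma laws and of their Poisson mixtures\<close>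

text \<open>The substitution \<open>y = x * t\<close> turns the convolution into a Beta integral,
  and \<open>Beta b a = Gamma a * Gamma b / Gamma (a + b)\<close> gives the new
  normalization.\<close>

lemma gamma_density_convolution:
  assumes a: "a > 0" and b: "b > 0"
  shows "(\<integral>\<^sup>+y. ennreal (gamma_density a (x - y)) * ennreal (gamma_density b y) \<partial>lborel)
    = ennreal (gamma_density (a + b) x)"
proof (cases "x > 0")
  case True
  define h where "h t = (if t \<in> {0..1} then t powr (b - 1) * (1 - t) powr (a - 1) else 0)" for t :: real
  have [measurable]: "h \<in> borel_measurable borel"
    unfolding h_def by measurable
  have "((\<lambda>t. h t) has_integral Beta b a) UNIV"
    unfolding h_def by (rule has_integral_restrict_UNIV[THEN iffD2, OF has_integral_Beta_real[OF b a]])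
  then have B: "(\<integral>\<^sup>+t. ennreal (h t) \<partial>lborel) = ennreal (Beta b a)"
    by (intro nn_integral_has_integral_lborel) (auto simp: h_def)
  \<comment> \<open>Everything in the integrand that does not depend on \<open>t\<close>; the
    Jacobian \<open>x\<close> later raises the power to \<open>a + b - 1\<close>.\<close>
  define c where "c = x powr (a + b - 2) * exp (- x) / (Gamma a * Gamma b)"
  have c: "c \<ge> 0" unfolding c_def using a b by (simp add: Gamma_real_pos less_imp_le)
  have "(\<integral>\<^sup>+y. ennreal (gamma_density a (x - y)) * ennreal (gamma_density b y) \<partial>lborel)
    = ennreal x * (\<integral>\<^sup>+t. ennreal (gamma_density a (x - x * t)) * ennreal (gamma_density b (x * t)) \<partial>lborel)"
    using True by (subst nn_integral_real_affine[where t = 0 and c = x]) auto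
  also have "(\<integral>\<^sup>+t. ennreal (gamma_density a (x - x * t)) * ennreal (gamma_density b (x * t)) \<partial>lborel)
    = (\<integral>\<^sup>+t. ennreal c * ennreal (h t) \<partial>lborel)"
  proof (rule nn_integral_cong)
    fix t :: real
    have eq: "x - x * t = x * (1 - t)" by (simp add: algebra_simps)
    have "gamma_density a (x - x * t) * gamma_density b (x * t) = c * h t"
    proof (cases "0 < t \<and> t < 1")
      case t: True
      have E: "exp (- (x * (1 - t))) * exp (- (x * t)) = exp (- x)"
        by (simp add: algebra_simps flip: exp_add)
      have P: "x powr (a - 1) * x powr (b - 1) = x powr (a + b - 2)"
        by (simp add: algebra_simps flip: powr_add)
      have "gamma_density a (x * (1 - t)) * gamma_density b (x * t)
        = (x powr (a - 1) * x powr (b - 1)) * (exp (- (x * (1 - t))) * exp (- (x * t)))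
          / (Gamma a * Gamma b) * (t powr (b - 1) * (1 - t) powr (a - 1))"
        using t True by (simp add: gamma_density_def powr_mult)
      also have "\<dots> = c * h t"
        unfolding E P using t by (simp add: c_def h_def)
      finally show ?thesis unfolding eq .
    next
      case False
      \<comment> \<open>One of the two densities vanishes outside the open unit interval. At its
        endpoints \<open>h\<close> vanishes too, because \<open>0 powr z = 0\<close> for every
        \<open>z\<close>.\<close>
      then have "x * t \<le> 0 \<or> x * (1 - t) \<le> 0"
        using True by (auto simp: mult_le_0_iff)
      then show ?thesis using False unfolding eq gamma_density_def h_def by auto
    qed
    then show "ennreal (gamma_density a (x - x * t)) * ennreal (gamma_density b (x * t))
      = ennreal c * ennreal (h t)"
      using a b c by (simp add: gamma_density_nonneg h_def flip: ennreal_mult)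
  qed
  also have "\<dots> = ennreal c * ennreal (Beta b a)"
    by (simp add: nn_integral_cmult B)
  also have "ennreal x * (ennreal c * ennreal (Beta b a)) = ennreal (x * (c * Beta b a))"
    using True c by (simp only: ennreal_mult'[symmetric] less_imp_le)
  also have "x * (c * Beta b a) = gamma_density (a + b) x"
  proof -
    have "x * x powr (a + b - 2) = x powr (a + b - 1)"
      using True powr_add[of x 1 "a + b - 2"] by simp
    moreover have "Gamma a > 0" "Gamma b > 0" "Gamma (a + b) > 0"
      using a b by (auto intro: Gamma_real_pos)
    ultimately show ?thesis
      using True by (simp add: c_def Beta_def gamma_density_def add.commute field_simps)
  qed
  finally show ?thesis .
next
  case False
  then have "ennreal (gamma_density a (x - y)) * ennreal (gamma_density b y) = 0" for y
    by (cases "y > 0") (auto simp: gamma_density_def)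
  moreover from False have "gamma_density (a + b) x = 0"
    by (simp add: gamma_density_def)
  ultimately show ?thesis by (simp only: nn_integral_const mult_zero_left ennreal_0)
qed

text \<open>Row \<open>k\<close> is shifted by \<open>k\<close>, so that its terms are indexed by
  \<open>n = k + l\<close>; the two sums over nonnegative terms are then exchanged, and for fixed
  \<open>n\<close> only \<open>k \<le> n\<close> contributes.\<close>

lemma suminf_ennreal_antidiagonals:
  fixes F :: "nat \<Rightarrow> nat \<Rightarrow> ennreal"
  shows "(\<Sum>k. \<Sum>l. F k l) = (\<Sum>n. \<Sum>k\<le>n. F k (n - k))"
proof -
  have "(\<Sum>l. F k l) = (\<Sum>n. F k (n - k) * indicator {k..} n)" for k
  proof -
    have "bij_betw (\<lambda>l. l + k) UNIV {k..}"
      by (intro bij_betwI[where g = "\<lambda>n. n - k"]) auto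
    from nn_integral_bij_count_space[OF this, of "\<lambda>n. F k (n - k)"]
    show ?thesis
      by (simp add: nn_integral_count_space_nat[symmetric] nn_integral_count_space_indicator mult.commute)
  qed
  then have "(\<Sum>k. \<Sum>l. F k l) = (\<Sum>k. \<integral>\<^sup>+n. F k (n - k) * indicator {k..} n \<partial>count_space UNIV)"
    by (simp add: nn_integral_count_space_nat)
  also have "\<dots> = (\<integral>\<^sup>+n. (\<Sum>k. F k (n - k) * indicator {k..} n) \<partial>count_space UNIV)"
    by (rule nn_integral_suminf[symmetric]) simp
  also have "\<dots> = (\<Sum>n. \<Sum>k. F k (n - k) * indicator {k..} n)"
    by (simp add: nn_integral_count_space_nat)
  also have "\<dots> = (\<Sum>n. \<Sum>k\<le>n. F k (n - k))"
  proof (rule suminf_cong)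
    show "(\<Sum>k. F k (n - k) * indicator {k..} n) = (\<Sum>k\<le>n. F k (n - k))" for n
      by (subst suminf_finite[of "{..n}"]) auto
  qed
  finally show ?thesis .
qed

text \<open>This is the binomial theorem; in probabilistic terms, independent Poisson variables add
  up to a Poisson variable.\<close>

lemma poisson_weight_add:
  "(\<Sum>k\<le>n. poisson_weight l k * poisson_weight m (n - k)) = poisson_weight (l + m) n"
proof -
  have "poisson_weight (l + m) n
    = (\<Sum>k\<le>n. (of_nat (n choose k) * l ^ k * m ^ (n - k)) / fact n * exp (- (l + m)))"
    by (simp add: poisson_weight_def binomial_ring sum_distrib_right sum_divide_distrib)
  also have "\<dots> = (\<Sum>k\<le>n. poisson_weight l k * poisson_weight m (n - k))"
    by (intro sum.cong refl)
       (simp add: poisson_weight_def binomial_fact exp_add[symmetric] field_simps exp_minus exp_add)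
  finally show ?thesis ..
qed

text \<open>After multiplying out the two mixtures, the convolution of the Gamma components depends
  only on \<open>k + j\<close>. Summing along antidiagonals therefore collects the weights into
  those of the parameter \<open>l + m\<close>.\<close>

lemma nc_gamma_density_convolution:
  assumes a: "a > 0" and b: "b > 0" and l: "l \<ge> 0" and m: "m \<ge> 0"
  shows "(\<integral>\<^sup>+y. nc_gamma_density a l (x - y) * nc_gamma_density b m y \<partial>lborel)
    = nc_gamma_density (a + b) (l + m) x"
proof -
  let ?W = "\<lambda>k j. ennreal (poisson_weight l k) * ennreal (poisson_weight m j)"
  let ?G = "\<lambda>k j y. ennreal (gamma_density (a + real k) (x - y)) * ennreal (gamma_density (b + real j) y)"
  have "(\<integral>\<^sup>+y. nc_gamma_density a l (x - y) * nc_gamma_density b m y \<partial>lborel)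
    = (\<integral>\<^sup>+y. (\<Sum>k. \<Sum>j. ?W k j * ?G k j y) \<partial>lborel)"
    unfolding nc_gamma_density_def
    by (simp add: mult_ac flip: ennreal_suminf_cmult ennreal_suminf_multc)
  also have "\<dots> = (\<Sum>k. \<Sum>j. ?W k j * (\<integral>\<^sup>+y. ?G k j y \<partial>lborel))"
    by (simp add: nn_integral_suminf nn_integral_cmult)
  also have "\<dots> = (\<Sum>k. \<Sum>j. ?W k j * ennreal (gamma_density (a + b + real (k + j)) x))"
    using a b by (subst gamma_density_convolution) (auto simp: algebra_simps)
  also have "\<dots> = (\<Sum>n. \<Sum>k\<le>n. ?W k (n - k) * ennreal (gamma_density (a + b + real n) x))"
    by (subst suminf_ennreal_antidiagonals) simp
  also have "\<dots> = nc_gamma_density (a + b) (l + m) x"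
    unfolding nc_gamma_density_def poisson_weight_add[symmetric]
    by (simp add: sum_ennreal[symmetric] sum_distrib_right ennreal_mult poisson_weight_nonneg l m)
  finally show ?thesis .
qed

section \<open>The square of a shifted Gaussian variable\<close>

text \<open>The substitution rule on compact intervals is carried to the half-line by monotone
  exhaustion. It is used with \<open>c = 1\<close> for squares of Gaussians and with
  \<open>c = 1 / 2\<close> for the Marcum integral.\<close>

lemma nn_integral_square_substitution:
  fixes f :: "real \<Rightarrow> ennreal" and c :: real
  assumes [measurable]: "f \<in> borel_measurable borel" and c: "c > 0"
  shows "(\<integral>\<^sup>+s. f s * indicator {0..} s \<partial>lborel)
    = (\<integral>\<^sup>+x. f (c * x\<^sup>2) * ennreal (2 * c * x) * indicator {0..} x \<partial>lborel)"
proof -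
  let ?g = "\<lambda>x. f (c * x\<^sup>2) * ennreal (2 * c * x)"
  \<comment> \<open>\<open>Suc n\<close> instead of \<open>n\<close> keeps the interval of
    integration nondegenerate.\<close>
  have step: "emeasure (density lborel f) {0..c * (real (Suc n))\<^sup>2} = emeasure (density lborel ?g) {0..real (Suc n)}" for n
  proof -
    have "(\<integral>\<^sup>+s. f s * indicator {c * 0\<^sup>2..c * (real (Suc n))\<^sup>2} s \<partial>lborel)
      = (\<integral>\<^sup>+x. ?g x * indicator {0..real (Suc n)} x \<partial>lborel)"
      by (rule nn_integral_substitution_aux)
         (use c in \<open>auto intro!: derivative_eq_intros continuous_intros\<close>)
    then show ?thesis by (simp add: emeasure_density)
  qed
  have sup_f: "(SUP n. emeasure (density lborel f) {0..c * (real (Suc n))\<^sup>2}) = emeasure (density lborel f) {0..}"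
  proof -
    have "incseq (\<lambda>n. {0..c * (real (Suc n))\<^sup>2})"
      using c by (intro incseq_SucI) (auto intro: order_trans)
    moreover have "(\<Union>n. {0..c * (real (Suc n))\<^sup>2}) = {0..}"
    proof (intro equalityI subsetI)
      fix s :: real assume s: "s \<in> {0..}"
      obtain n where n: "s / c \<le> real n" using real_arch_simple by blast
      also have "real n \<le> (real (Suc n))\<^sup>2" by (simp add: power2_eq_square algebra_simps)
      finally have "s \<le> c * (real (Suc n))\<^sup>2" using c by (simp add: field_simps)
      then show "s \<in> (\<Union>n. {0..c * (real (Suc n))\<^sup>2})" using s by auto
    qed auto
    ultimately show ?thesis by (subst SUP_emeasure_incseq) auto
  qed
  have sup_g: "(SUP n. emeasure (density lborel ?g) {0..real (Suc n)}) = emeasure (density lborel ?g) {0..}"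
  proof -
    have "incseq (\<lambda>n. {0..real (Suc n)})"
      by (intro incseq_SucI) auto
    moreover have "(\<Union>n. {0..real (Suc n)}) = {0..}"
    proof (intro equalityI subsetI)
      fix s :: real assume s: "s \<in> {0..}"
      obtain n where "s \<le> real n" using real_arch_simple by blast
      then have "s \<le> real (Suc n)" by simp
      then show "s \<in> (\<Union>n. {0..real (Suc n)})" using s by auto
    qed auto
    ultimately show ?thesis by (subst SUP_emeasure_incseq) auto
  qed
  have "emeasure (density lborel f) {0..} = emeasure (density lborel ?g) {0..}"
    unfolding sup_f[symmetric] sup_g[symmetric] step ..
  then show ?thesis by (simp add: emeasure_density)
qed

text \<open>Legendre's duplication formula at half-integers, by induction from
  \<open>Gamma (1 / 2) = sqrt pi\<close>. It turns the coefficients of the shape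
  \<open>1 / 2\<close> mixture into the coefficients \<open>1 / fact (2 * k)\<close> of
  \<open>cosh\<close>.\<close>

lemma fact_Gamma_half: "fact k * Gamma (1 / 2 + real k) * 4 ^ k = sqrt pi * fact (2 * k)"
proof (induction k)
  case (Suc k)
  have "Gamma (1 / 2 + real (Suc k)) = (1 / 2 + real k) * Gamma (1 / 2 + real k)"
    using Gamma_plus1[of "1 / 2 + real k"] nonpos_Ints_nonpos[of "1 / 2 + real k"]
    by (force simp: add_ac)
  then have "fact (Suc k) * Gamma (1 / 2 + real (Suc k)) * 4 ^ Suc k
    = (real k + 1) * (1 / 2 + real k) * 4 * (fact k * Gamma (1 / 2 + real k) * 4 ^ k)"
    by (simp add: algebra_simps)
  also have "\<dots> = sqrt pi * fact (2 * Suc k)"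
    unfolding Suc by (simp add: algebra_simps)
  finally show ?case .
qed (simp add: Gamma_one_half_real)

lemma sums_cosh_even: "(\<lambda>k. x ^ (2 * k) / fact (2 * k)) sums cosh (x :: real)"
proof -
  have "(\<lambda>n. if even n then x ^ n / fact n else 0) sums cosh x"
    using cosh_converges[of x] by (simp add: divide_inverse mult.commute cong: if_cong)
  then show ?thesis
    by (subst (asm) sums_mono_reindex[of "\<lambda>k. 2 * k", symmetric])
       (auto simp: strict_mono_def elim!: evenE)
qed

lemma normal_density_half: "normal_density 0 (sqrt (1 / 2)) z = exp (- z\<^sup>2) / sqrt pi"
  by (simp add: normal_density_def)

text \<open>Up to the factor \<open>2 exp (- v\<^sup>2 - w\<^sup>2) / sqrt pi\<close>, the left-hand side is the power series of \<open>cosh (2 v w)\<close>.\<close>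

lemma nc_gamma_density_half:
  assumes w: "w > 0"
  shows "nc_gamma_density (1 / 2) (v\<^sup>2) (w\<^sup>2) * ennreal (2 * w)
    = ennreal (normal_density 0 (sqrt (1 / 2)) (w - v)) + ennreal (normal_density 0 (sqrt (1 / 2)) (- w - v))"
proof -
  let ?c = "2 * exp (- v\<^sup>2 - w\<^sup>2) / sqrt pi"
  have term_eq: "poisson_weight (v\<^sup>2) k * gamma_density (1 / 2 + real k) (w\<^sup>2) * (2 * w)
    = ?c * ((2 * v * w) ^ (2 * k) / fact (2 * k))" for k
  proof -
    have G: "Gamma (1 / 2 + real k) = sqrt pi * fact (2 * k) / (fact k * 4 ^ k)"
      using fact_Gamma_half[of k] by (simp add: field_simps)
    \<comment> \<open>The factor \<open>w\<close> comes from the Jacobian \<open>2 * w\<close> and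
      makes the half-integral power of \<open>w\<^sup>2\<close> an even power of
      \<open>w\<close>.\<close>
    have "(w\<^sup>2) powr (1 / 2 + real k - 1) * w = w powr (2 * (1 / 2 + real k - 1)) * w powr 1"
      using w by (simp add: powr_powr flip: powr_numeral)
    also have "\<dots> = w powr (real (2 * k))"
      unfolding powr_add[symmetric] by (simp add: algebra_simps)
    also have "\<dots> = w ^ (2 * k)"
      using w by (rule powr_realpow)
    finally have P: "(w\<^sup>2) powr (1 / 2 + real k - 1) * w = w ^ (2 * k)" .
    have "poisson_weight (v\<^sup>2) k * gamma_density (1 / 2 + real k) (w\<^sup>2) * (2 * w)
      = 2 * ((v\<^sup>2) ^ k * exp (- v\<^sup>2)) * ((w\<^sup>2) powr (1 / 2 + real k - 1) * w) * exp (- w\<^sup>2)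
        / (fact k * Gamma (1 / 2 + real k))"
      using w by (simp add: poisson_weight_def gamma_density_def)
    also have "\<dots> = ?c * ((2 * v * w) ^ (2 * k) / fact (2 * k))"
    proof -
      have eq: "(2 * v * w) ^ (2 * k) = 4 ^ k * (v\<^sup>2) ^ k * w ^ (2 * k)"
        by (simp add: power_mult power_mult_distrib)
      show ?thesis
        unfolding P unfolding G eq by (simp add: exp_diff exp_minus field_simps)
    qed
    finally show ?thesis .
  qed
  have "nc_gamma_density (1 / 2) (v\<^sup>2) (w\<^sup>2) * ennreal (2 * w)
    = (\<Sum>k. ennreal (poisson_weight (v\<^sup>2) k) * ennreal (gamma_density (1 / 2 + real k) (w\<^sup>2)) * ennreal (2 * w))"
    unfolding nc_gamma_density_def by simp
  also have "\<dots> = (\<Sum>k. ennreal (?c * ((2 * v * w) ^ (2 * k) / fact (2 * k))))"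
    unfolding term_eq[symmetric]
    using w by (simp add: ennreal_mult poisson_weight_nonneg gamma_density_nonneg)
  also have "\<dots> = ennreal (?c * cosh (2 * v * w))"
    by (intro suminf_ennreal_eq sums_mult sums_cosh_even) simp
  also have "?c * cosh (2 * v * w)
    = normal_density 0 (sqrt (1 / 2)) (w - v) + normal_density 0 (sqrt (1 / 2)) (- w - v)"
  proof -
    \<comment> \<open>Expanding the squares matches the two exponentials of \<open>cosh\<close> with
      the Gaussian values at \<open>w\<close> and at \<open>- w\<close>.\<close>
    have "- (w - v)\<^sup>2 = (- v\<^sup>2 - w\<^sup>2) + 2 * v * w" "- (- w - v)\<^sup>2 = (- v\<^sup>2 - w\<^sup>2) - 2 * v * w"
      by (simp_all add: power2_eq_square algebra_simps)
    then show ?thesis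
      unfolding normal_density_half
      by (simp only: exp_add exp_diff cosh_def) (simp add: exp_minus field_simps)
  qed
  finally show ?thesis by simp
qed

text \<open>The line is split at the null set \<open>{0}\<close> and the negative half is reflected;
  this accounts for the two preimages \<open>w\<close> and \<open>- w\<close> of a positive
  square.\<close>

lemma nn_integral_fold_abs:
  fixes f :: "real \<Rightarrow> ennreal"
  assumes [measurable]: "f \<in> borel_measurable borel"
  shows "(\<integral>\<^sup>+w. f w \<partial>lborel) = (\<integral>\<^sup>+w. (f w + f (- w)) * indicator {0<..} w \<partial>lborel)"
proof -
  have "(\<integral>\<^sup>+w. f w \<partial>lborel) = (\<integral>\<^sup>+w. f w * indicator {0<..} w + f w * indicator {..<0} w \<partial>lborel)"
    by (intro nn_integral_cong_AE, rule AE_mp[OF AE_lborel_singleton[of 0]])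
       (auto split: split_indicator)
  also have "\<dots> = (\<integral>\<^sup>+w. f w * indicator {0<..} w \<partial>lborel) + (\<integral>\<^sup>+w. f w * indicator {..<0} w \<partial>lborel)"
    by (rule nn_integral_add) auto
  also have "(\<integral>\<^sup>+w. f w * indicator {..<0} w \<partial>lborel) = (\<integral>\<^sup>+w. f (- w) * indicator {0<..} w \<partial>lborel)"
    by (subst nn_integral_real_affine[where c = "-1" and t = 0])
       (auto intro!: nn_integral_cong split: split_indicator)
  also have "(\<integral>\<^sup>+w. f w * indicator {0<..} w \<partial>lborel) + (\<integral>\<^sup>+w. f (- w) * indicator {0<..} w \<partial>lborel)
    = (\<integral>\<^sup>+w. (f w + f (- w)) * indicator {0<..} w \<partial>lborel)"
    by (subst nn_integral_add[symmetric]) (auto simp: distrib_right)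
  finally show ?thesis .
qed

lemma nc_gamma_density_nonpos: "x \<le> 0 \<Longrightarrow> nc_gamma_density a l x = 0"
  by (simp add: nc_gamma_density_def gamma_density_def)

text \<open>The integral of an indicator is translated by \<open>v\<close>, folded onto the positive
  half-line and substituted by \<open>s = w\<^sup>2\<close>. By
  \<open>nc_gamma_density_half\<close>, the two folded Gaussian values are the claimed density times
  the Jacobian.\<close>

lemma (in prob_space) distributed_shifted_normal_square:
  assumes X: "distributed M lborel X (normal_density 0 (sqrt (1 / 2)))"
  shows "distributed M lborel (\<lambda>\<omega>. (X \<omega> + v)\<^sup>2) (nc_gamma_density (1 / 2) (v\<^sup>2))"
proof -
  have [measurable]: "X \<in> borel_measurable M"
    using distributed_measurable[OF X] by simp
  let ?\<phi> = "\<lambda>z. ennreal (normal_density 0 (sqrt (1 / 2)) z)"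
  let ?p = "nc_gamma_density (1 / 2) (v\<^sup>2)"
  have "distr M lborel (\<lambda>\<omega>. (X \<omega> + v)\<^sup>2) = density lborel ?p"
  proof (rule measure_eqI)
    fix A assume "A \<in> sets (distr M lborel (\<lambda>\<omega>. (X \<omega> + v)\<^sup>2))"
    then have [measurable]: "A \<in> sets borel" by simp
    have "emeasure (distr M lborel (\<lambda>\<omega>. (X \<omega> + v)\<^sup>2)) A
      = (\<integral>\<^sup>+\<omega>. indicator A ((X \<omega> + v)\<^sup>2) \<partial>M)"
      by (simp add: nn_integral_distr flip: nn_integral_indicator)
    also have "\<dots> = (\<integral>\<^sup>+z. ?\<phi> z * indicator A ((z + v)\<^sup>2) \<partial>lborel)"
      by (rule distributed_nn_integral[OF X, symmetric]) simp
    also have "\<dots> = (\<integral>\<^sup>+w. ?\<phi> (w - v) * indicator A (w\<^sup>2) \<partial>lborel)"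
      by (subst nn_integral_real_affine[where c = 1 and t = "- v"]) simp_all
    also have "\<dots> = (\<integral>\<^sup>+w. (?\<phi> (w - v) * indicator A (w\<^sup>2) + ?\<phi> (- w - v) * indicator A (w\<^sup>2))
        * indicator {0<..} w \<partial>lborel)"
      by (subst nn_integral_fold_abs) simp_all
    also have "\<dots> = (\<integral>\<^sup>+w. (?p (1 * w\<^sup>2) * indicator A (1 * w\<^sup>2)) * ennreal (2 * 1 * w) * indicator {0..} w \<partial>lborel)"
    proof (rule nn_integral_cong)
      fix w :: real
      show "(?\<phi> (w - v) * indicator A (w\<^sup>2) + ?\<phi> (- w - v) * indicator A (w\<^sup>2)) * indicator {0<..} w
        = (?p (1 * w\<^sup>2) * indicator A (1 * w\<^sup>2)) * ennreal (2 * 1 * w) * indicator {0..} w"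
        using nc_gamma_density_half[of w v]
        \<comment> \<open>At \<open>w = 0\<close> the left side vanishes by its strict indicator and
          the right side by the factor \<open>2 * 1 * w\<close>.\<close>
        by (cases "w > 0"; cases "w = 0") (auto simp: split: split_indicator)
    qed
    also have "\<dots> = (\<integral>\<^sup>+s. (?p s * indicator A s) * indicator {0..} s \<partial>lborel)"
      by (subst nn_integral_square_substitution[where c = 1]) simp_all
    also have "\<dots> = (\<integral>\<^sup>+s. ?p s * indicator A s \<partial>lborel)"
      by (intro nn_integral_cong) (auto simp: nc_gamma_density_nonpos split: split_indicator)
    also have "\<dots> = emeasure (density lborel ?p) A"
      by (simp add: emeasure_density)
    finally show "emeasure (distr M lborel (\<lambda>\<omega>. (X \<omega> + v)\<^sup>2)) A = emeasure (density lborel ?p) A" .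
  qed simp
  then show ?thesis
    unfolding distributed_def by simp
qed

section \<open>Sums of independent shifted squares\<close>

text \<open>Induction on \<open>I\<close>, since shapes and noncentralities add under convolution.
  It starts at singletons: an empty sum is the constant \<open>0\<close>, which has no
  density.\<close>

lemma (in prob_space) distributed_sum_nc_gamma:
  assumes "finite I" "I \<noteq> {}" "indep_vars (\<lambda>_. borel) X I"
    and "\<And>i. i \<in> I \<Longrightarrow> a i > 0" "\<And>i. i \<in> I \<Longrightarrow> l i \<ge> 0"
    and "\<And>i. i \<in> I \<Longrightarrow> distributed M lborel (X i) (nc_gamma_density (a i) (l i))"
  shows "distributed M lborel (\<lambda>\<omega>. \<Sum>i\<in>I. X i \<omega>) (nc_gamma_density (\<Sum>i\<in>I. a i) (\<Sum>i\<in>I. l i))"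
  using assms
proof (induct I rule: finite_ne_induct)
  case (insert i I)
  have 1: "indep_var borel (X i) borel (\<lambda>\<omega>. \<Sum>i\<in>I. X i \<omega>)"
    using insert by (intro indep_vars_sum) auto
  have 2: "distributed M lborel (\<lambda>\<omega>. \<Sum>i\<in>I. X i \<omega>) (nc_gamma_density (\<Sum>i\<in>I. a i) (\<Sum>i\<in>I. l i))"
    using insert by (intro insert.hyps(4)) (auto intro: indep_vars_subset)
  have "distributed M lborel (\<lambda>\<omega>. X i \<omega> + (\<Sum>i\<in>I. X i \<omega>))
    (\<lambda>x. \<integral>\<^sup>+y. nc_gamma_density (a i) (l i) (x - y) * nc_gamma_density (\<Sum>i\<in>I. a i) (\<Sum>i\<in>I. l i) y \<partial>lborel)"
    using insert by (intro distributed_convolution[OF 1 _ 2]) auto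
  also have "(\<lambda>x. \<integral>\<^sup>+y. nc_gamma_density (a i) (l i) (x - y) * nc_gamma_density (\<Sum>i\<in>I. a i) (\<Sum>i\<in>I. l i) y \<partial>lborel)
    = nc_gamma_density (a i + (\<Sum>i\<in>I. a i)) (l i + (\<Sum>i\<in>I. l i))"
    using insert by (intro ext nc_gamma_density_convolution sum_pos sum_nonneg) auto
  finally show ?case using insert by simp
qed simp

lemma (in prob_space) distributed_sum_shifted_normal_squares:
  assumes I: "finite I" "I \<noteq> {}" and ind: "indep_vars (\<lambda>_. borel) X I"
    and X: "\<And>i. i \<in> I \<Longrightarrow> distributed M lborel (X i) (normal_density 0 (sqrt (1 / 2)))"
  shows "distributed M lborel (\<lambda>\<omega>. \<Sum>i\<in>I. (X i \<omega> + v i)\<^sup>2)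
    (nc_gamma_density (real (card I) / 2) (\<Sum>i\<in>I. (v i)\<^sup>2))"
proof -
  have "indep_vars (\<lambda>_. borel) (\<lambda>i \<omega>. (X i \<omega> + v i)\<^sup>2) I"
    by (rule indep_vars_compose2[OF ind, where Y = "\<lambda>i z. (z + v i)\<^sup>2"]) simp
  from distributed_sum_nc_gamma[OF I this, where a = "\<lambda>_. 1 / 2" and l = "\<lambda>i. (v i)\<^sup>2"]
  show ?thesis using X by (simp add: distributed_shifted_normal_square)
qed

section \<open>Monotonicity in the noncentrality\<close>

text \<open>The derivative of the mixture in the Poisson parameter is the mixture of \<open>G (k + 1) - G k\<close>.\<close>

lemma poisson_mixture_antimono:
  assumes G: "\<And>k. G (Suc k) \<le> G k" and G01: "\<And>k. 0 \<le> G k" "\<And>k. G k \<le> (1 :: real)"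
    and l: "0 \<le> l" "l \<le> m"
  shows "(\<Sum>k. poisson_weight m k * G k) \<le> (\<Sum>k. poisson_weight l k * G k)"
proof -
  have summable: "summable (\<lambda>k. H k / fact k * y ^ k)" if "\<And>k. 0 \<le> H k" "\<And>k. H k \<le> 1" for H :: "nat \<Rightarrow> real" and y :: real
  proof (rule summable_comparison_test'[of "\<lambda>k. \<bar>y\<bar> ^ k / fact k"])
    show "summable (\<lambda>k. \<bar>y\<bar> ^ k / fact k)"
      using summable_exp[of "\<bar>y\<bar>"] by (simp add: field_simps)
    show "norm (H k / fact k * y ^ k) \<le> \<bar>y\<bar> ^ k / fact k" for k
      using that[of k] by (simp add: abs_mult power_abs divide_right_mono mult_left_le_one_le)
  qed
  let ?S = "\<lambda>H x. \<Sum>k. H k / fact k * x ^ k"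
  \<comment> \<open>With the factor \<open>exp (- x)\<close> taken out of the sum, the mixture is an
    everywhere convergent power series times an exponential and can be differentiated
    termwise.\<close>
  define f where "f x = ?S G x * exp (- x)" for x
  have mix: "(\<Sum>k. poisson_weight x k * G k) = f x" for x
    unfolding f_def using suminf_mult2[OF summable[of G x, OF G01], of "exp (- x)"]
    by (simp add: poisson_weight_def field_simps)
  have deriv: "\<exists>y. (f has_real_derivative y) (at x) \<and> y \<le> 0" if x: "l \<le> x" for x
  proof (intro exI conjI)
    have "diffs (\<lambda>k. G k / fact k) = (\<lambda>k. G (Suc k) / fact k)"
      by (simp add: diffs_def del: of_nat_Suc)
    then have "(?S G has_real_derivative ?S (\<lambda>k. G (Suc k)) x) (at x)"
      using termdiffs_strong_converges_everywhere[OF summable[of G, OF G01], of x] by simp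
    then show "(f has_real_derivative (?S (\<lambda>k. G (Suc k)) x - ?S G x) * exp (- x)) (at x)"
      unfolding f_def by (auto intro!: derivative_eq_intros simp: algebra_simps)
    have "?S (\<lambda>k. G (Suc k)) x \<le> ?S G x"
      using G G01 x l by (intro suminf_le summable mult_right_mono divide_right_mono) auto
    then show "(?S (\<lambda>k. G (Suc k)) x - ?S G x) * exp (- x) \<le> 0"
      by (simp add: mult_nonpos_nonneg)
  qed
  have "f m \<le> f l"
    by (rule DERIV_nonpos_imp_nonincreasing[OF l(2) deriv])
  then show ?thesis by (simp add: mix)
qed

section \<open>The distribution function of the noncentral law\<close>

text \<open>The distribution function at \<open>b\<close> for shape \<open>N\<close> and
  noncentrality \<open>l\<close>. The index is \<open>N - 1 + k\<close> because
  \<open>erlang_density n\<close> has shape \<open>n + 1\<close>.\<close>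

definition nc_gamma_cdf :: "nat \<Rightarrow> real \<Rightarrow> real \<Rightarrow> real" where
  "nc_gamma_cdf N l b = (\<Sum>k. poisson_weight l k * erlang_CDF (N - 1 + k) 1 b)"

lemma erlang_CDF_le_1: "erlang_CDF k 1 b \<le> 1"
  by (auto simp: erlang_CDF_def intro!: sum_nonneg)

text \<open>For \<open>b \<ge> 0\<close> the closed form is one minus a Poisson partial sum, and a
  larger index subtracts one more nonnegative term.\<close>

lemma erlang_CDF_Suc_le: "erlang_CDF (Suc k) 1 b \<le> erlang_CDF k 1 b"
  by (auto simp: erlang_CDF_def)

text \<open>A larger Poisson parameter favours larger shapes, whose distribution functions are
  smaller. This lets the conditional probability be bounded by its value at the boundary.\<close>

lemma nc_gamma_cdf_antimono: "0 \<le> l \<Longrightarrow> l \<le> m \<Longrightarrow> nc_gamma_cdf N m b \<le> nc_gamma_cdf N l b"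
  unfolding nc_gamma_cdf_def
  by (rule poisson_mixture_antimono) (simp_all add: erlang_CDF_Suc_le erlang_CDF_le_1)

lemma nc_gamma_cdf_summable:
  "0 \<le> l \<Longrightarrow> summable (\<lambda>k. poisson_weight l k * erlang_CDF (N - 1 + k) 1 b)"
  by (rule summable_comparison_test'[OF sums_summable[OF poisson_weight_sums[of l]]])
     (simp add: poisson_weight_nonneg erlang_CDF_le_1 mult_left_le)

lemma nc_gamma_cdf_nonneg: "0 \<le> l \<Longrightarrow> 0 \<le> nc_gamma_cdf N l b"
  unfolding nc_gamma_cdf_def
  by (intro suminf_nonneg nc_gamma_cdf_summable mult_nonneg_nonneg) (simp_all add: poisson_weight_nonneg)

text \<open>The point \<open>0\<close> is excluded: there \<open>erlang_density 0 1\<close> has the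
  value \<open>1\<close>, while \<open>gamma_density\<close> is \<open>0\<close>.\<close>

lemma gamma_density_eq_erlang_density:
  assumes "N \<ge> 1" "x \<noteq> 0"
  shows "gamma_density (real N + real k) x = erlang_density (N - 1 + k) 1 x"
proof -
  have "Gamma (real N + real k) = fact (N - 1 + k)"
    using Gamma_fact[of "N - 1 + k", where ?'a = real] assms by (simp add: of_nat_diff algebra_simps)
  moreover have "x powr (real N + real k - 1) = x ^ (N - 1 + k)" if "x > 0"
    using that assms powr_realpow[of x "N - 1 + k"] by (simp add: of_nat_diff algebra_simps)
  ultimately show ?thesis
    using assms by (auto simp: gamma_density_def erlang_density_def)
qed

text \<open>Sum and integral commute for nonnegative terms, and the Gamma and Erlang densities agree
  off the null set \<open>{0}\<close>.\<close>

lemma nn_integral_nc_gamma_density: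
  assumes "N \<ge> 1" and [measurable]: "A \<in> sets borel"
  shows "(\<integral>\<^sup>+x. nc_gamma_density (real N) l x * indicator A x \<partial>lborel)
    = (\<Sum>k. ennreal (poisson_weight l k) * emeasure (density lborel (erlang_density (N - 1 + k) 1)) A)"
proof -
  have "(\<integral>\<^sup>+x. nc_gamma_density (real N) l x * indicator A x \<partial>lborel)
    = (\<integral>\<^sup>+x. (\<Sum>k. ennreal (poisson_weight l k) * (ennreal (erlang_density (N - 1 + k) 1 x) * indicator A x)) \<partial>lborel)"
  proof (rule nn_integral_cong_AE, rule AE_mp[OF AE_lborel_singleton[of 0]], intro AE_I2 impI)
    fix x :: real assume "x \<noteq> 0"
    then show "nc_gamma_density (real N) l x * indicator A x
      = (\<Sum>k. ennreal (poisson_weight l k) * (ennreal (erlang_density (N - 1 + k) 1 x) * indicator A x))"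
      unfolding nc_gamma_density_def
      by (simp add: gamma_density_eq_erlang_density[OF assms(1)] mult.assoc flip: ennreal_suminf_multc)
  qed
  also have "\<dots> = (\<Sum>k. ennreal (poisson_weight l k) * emeasure (density lborel (erlang_density (N - 1 + k) 1)) A)"
    by (simp add: nn_integral_suminf nn_integral_cmult emeasure_density)
  finally show ?thesis .
qed

lemma emeasure_nc_gamma_atMost:
  assumes "N \<ge> 1" "l \<ge> 0"
  shows "emeasure (density lborel (nc_gamma_density (real N) l)) {..b} = ennreal (nc_gamma_cdf N l b)"
proof -
  have "emeasure (density lborel (nc_gamma_density (real N) l)) {..b}
    = (\<Sum>k. ennreal (poisson_weight l k * erlang_CDF (N - 1 + k) 1 b))"
    using assms
    by (simp add: emeasure_density nn_integral_nc_gamma_density nn_integral_erlang_density ennreal_mult poisson_weight_nonneg)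
  also have "\<dots> = ennreal (nc_gamma_cdf N l b)"
    unfolding nc_gamma_cdf_def
    using assms by (intro suminf_ennreal2 nc_gamma_cdf_summable mult_nonneg_nonneg) (simp_all add: poisson_weight_nonneg)
  finally show ?thesis .
qed

lemma prob_space_nc_gamma:
  assumes "N \<ge> 1" "l \<ge> 0"
  shows "prob_space (density lborel (nc_gamma_density (real N) l))"
proof
  have "emeasure (density lborel (erlang_density k 1)) UNIV = 1" for k
    using prob_space.emeasure_space_1[OF prob_space_erlang_density[of 1 k]] by simp
  then show "emeasure (density lborel (nc_gamma_density (real N) l)) (space (density lborel (nc_gamma_density (real N) l))) = 1"
    using assms nn_integral_nc_gamma_density[of N UNIV l]
    by (simp add: emeasure_density suminf_ennreal_eq[OF _ poisson_weight_sums] poisson_weight_nonneg flip: sums_unique[OF poisson_weight_sums])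
qed

lemma measure_nc_gamma_atLeast:
  assumes "N \<ge> 1" "l \<ge> 0"
  shows "measure (density lborel (nc_gamma_density (real N) l)) {b..} = 1 - nc_gamma_cdf N l b"
proof -
  interpret prob_space "density lborel (nc_gamma_density (real N) l)"
    by (rule prob_space_nc_gamma[OF assms])
  have "prob {b} = 0"
    by (simp add: measure_def emeasure_density nn_integral_null_set)
  have eq: "{b..} = {b<..} \<union> {b}" by auto
  have "prob {b..} = prob {b<..} + prob {b}"
    unfolding eq by (rule finite_measure_Union) auto
  also have "prob {b} = 0"
    by fact
  also have "prob {b<..} = 1 - prob {..b}"
    using prob_compl[of "{..b}"] by (simp add: Compl_eq_Diff_UNIV[symmetric])
  also have "prob {..b} = nc_gamma_cdf N l b"
    using assms by (simp add: measure_def emeasure_nc_gamma_atMost nc_gamma_cdf_nonneg)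
  finally show ?thesis by simp
qed

section \<open>Incomplete gamma and Marcum functions\<close>

text \<open>At parameter \<open>0\<close> the Poisson weights are concentrated at
  \<open>k = 0\<close>, which leaves the central Gamma law, the law of the squared norm of the
  common vector.\<close>

lemma nc_gamma_cdf_zero_noncentrality:
  assumes "N \<ge> 1" "b \<ge> 0"
  shows "nc_gamma_cdf N 0 b = 1 / fact (N - 1) * lower_inc_gamma N b"
proof -
  have "nc_gamma_cdf N 0 b = erlang_CDF (N - 1) 1 b"
    unfolding nc_gamma_cdf_def poisson_weight_def
    by (subst suminf_finite[of "{0}"]) auto
  also have "\<dots> = enn2real (\<integral>\<^sup>+x. ennreal (erlang_density (N - 1) 1 x) * indicator {..b} x \<partial>lborel)"
    by (simp add: nn_integral_erlang_density)
  also have "\<dots> = enn2real (\<integral>\<^sup>+x. ennreal (indicator {0..b} x * (x ^ (N - 1) * exp (- x)) / fact (N - 1)) \<partial>lborel)"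
    by (intro arg_cong[of _ _ enn2real] nn_integral_cong)
       (auto simp: erlang_density_def split: split_indicator)
  also have "\<dots> = (\<integral>x. indicator {0..b} x * (x ^ (N - 1) * exp (- x)) / fact (N - 1) \<partial>lborel)"
    by (intro integral_eq_nn_integral[symmetric]) (auto split: split_indicator)
  also have "\<dots> = 1 / fact (N - 1) * lower_inc_gamma N b"
    by (simp add: lower_inc_gamma_def set_lebesgue_integral_def)
  finally show ?thesis .
qed

text \<open>Bounding \<open>1 / fact (k + n)\<close> by \<open>1\<close> leaves a multiple of the
  exponential series at \<open>(x / 2)\<^sup>2\<close>.\<close>

lemma summable_bessel_I:
  fixes x :: real
  shows "summable (\<lambda>k. (x / 2) ^ (2 * k + n) / (fact k * fact (k + n)))"
proof (rule summable_comparison_test'[of "\<lambda>k. \<bar>x / 2\<bar> ^ n * (((x / 2)\<^sup>2) ^ k / fact k)"])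
  show "summable (\<lambda>k. \<bar>x / 2\<bar> ^ n * (((x / 2)\<^sup>2) ^ k / fact k))"
    using summable_exp[of "(x / 2)\<^sup>2"] by (intro summable_mult) (simp add: field_simps)
  fix k
  have "norm ((x / 2) ^ (2 * k + n)) = ((x / 2)\<^sup>2) ^ k * \<bar>x / 2\<bar> ^ n"
    by (simp only: real_norm_def power_add power_mult abs_mult power_abs power2_abs)
  then have "norm ((x / 2) ^ (2 * k + n) / (fact k * fact (k + n)))
    = \<bar>x / 2\<bar> ^ n * (((x / 2)\<^sup>2) ^ k / fact k) / fact (k + n)"
    by (simp add: norm_divide norm_mult)
  also have "\<dots> \<le> \<bar>x / 2\<bar> ^ n * (((x / 2)\<^sup>2) ^ k / fact k) / 1"
    by (intro divide_left_mono mult_nonneg_nonneg divide_nonneg_nonneg) (auto simp: fact_ge_1)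
  finally show "norm ((x / 2) ^ (2 * k + n) / (fact k * fact (k + n)))
    \<le> \<bar>x / 2\<bar> ^ n * (((x / 2)\<^sup>2) ^ k / fact k)" by simp
qed

lemma bessel_I_measurable [measurable]: "bessel_I n \<in> borel_measurable borel"
  unfolding bessel_I_def by measurable

lemma bessel_I_nonneg: "x \<ge> 0 \<Longrightarrow> 0 \<le> bessel_I n x"
  unfolding bessel_I_def by (intro suminf_nonneg summable_bessel_I) simp

text \<open>With noncentrality \<open>a\<^sup>2 / 2\<close> at the point
  \<open>x\<^sup>2 / 2\<close>, each mixture term times the Jacobian \<open>x\<close> is a term of
  the Bessel series; the identity \<open>P\<close> below redistributes the powers of
  \<open>a\<close> and \<open>x\<close>.\<close>

lemma nc_gamma_density_bessel:
  assumes N: "N \<ge> 1" and a: "a > 0" and x: "x \<ge> 0"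
  shows "nc_gamma_density (real N) (a\<^sup>2 / 2) (x\<^sup>2 / 2) * ennreal x
    = ennreal (x * (x / a) ^ (N - 1) * exp (- (x\<^sup>2 + a\<^sup>2) / 2) * bessel_I (N - 1) (a * x))"
proof (cases "x = 0")
  case False
  with x have x: "x > 0" by simp
  let ?c = "x * (x / a) ^ (N - 1) * exp (- (x\<^sup>2 + a\<^sup>2) / 2)"
  have term_eq: "poisson_weight (a\<^sup>2 / 2) k * gamma_density (real N + real k) (x\<^sup>2 / 2) * x
    = ?c * ((a * x / 2) ^ (2 * k + (N - 1)) / (fact k * fact (k + (N - 1))))" for k
  proof -
    have E: "exp (- (x\<^sup>2 + a\<^sup>2) / 2) = exp (- (a\<^sup>2 / 2)) * exp (- (x\<^sup>2 / 2))"
      by (simp add: field_simps flip: exp_add)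
    have P: "(a\<^sup>2 / 2) ^ k * (x\<^sup>2 / 2) ^ (N - 1 + k) = (x / a) ^ (N - 1) * (a * x / 2) ^ (2 * k + (N - 1))"
    proof -
      have 1: "(a * x / 2) ^ (2 * k) = (a\<^sup>2 / 2) ^ k * (x\<^sup>2 / 2) ^ k"
        by (simp add: power_mult power_mult_distrib[symmetric]) (simp add: power2_eq_square)
      have 2: "(x / a) ^ (N - 1) * (a * x / 2) ^ (N - 1) = (x\<^sup>2 / 2) ^ (N - 1)"
        unfolding power_mult_distrib[symmetric] using a by (simp add: power2_eq_square)
      show ?thesis
        unfolding power_add 1 2[symmetric] by simp
    qed
    have "poisson_weight (a\<^sup>2 / 2) k * gamma_density (real N + real k) (x\<^sup>2 / 2) * x
      = x * ((a\<^sup>2 / 2) ^ k * (x\<^sup>2 / 2) ^ (N - 1 + k)) * (exp (- (a\<^sup>2 / 2)) * exp (- (x\<^sup>2 / 2)))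
        / (fact k * fact (N - 1 + k))"
      using x by (subst gamma_density_eq_erlang_density[OF N])
        (simp_all add: poisson_weight_def erlang_density_def)
    also have "\<dots> = ?c * ((a * x / 2) ^ (2 * k + (N - 1)) / (fact k * fact (k + (N - 1))))"
      unfolding P E by (simp add: add.commute)
    finally show ?thesis .
  qed
  have pos: "real N + real k > 0" for k using N by simp
  have "nc_gamma_density (real N) (a\<^sup>2 / 2) (x\<^sup>2 / 2) * ennreal x
    = (\<Sum>k. ennreal (poisson_weight (a\<^sup>2 / 2) k) * ennreal (gamma_density (real N + real k) (x\<^sup>2 / 2)) * ennreal x)"
    unfolding nc_gamma_density_def by simp
  also have "\<dots> = (\<Sum>k. ennreal (?c * ((a * x / 2) ^ (2 * k + (N - 1)) / (fact k * fact (k + (N - 1))))))"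
    unfolding term_eq[symmetric]
    using x by (simp add: ennreal_mult poisson_weight_nonneg gamma_density_nonneg[OF pos])
  also have "\<dots> = ennreal (?c * bessel_I (N - 1) (a * x))"
    unfolding bessel_I_def
    using a x by (intro suminf_ennreal_eq sums_mult summable_sums summable_bessel_I) simp
  finally show ?thesis .
qed simp

text \<open>The substitution \<open>s = x\<^sup>2 / 2\<close> turns the tail integral of the
  noncentral density into the Marcum integral. The case \<open>l = 0\<close> is separate because
  \<open>marcum_Q\<close> is given there by the limit formula, a central Gamma tail.\<close>

lemma marcum_Q_eq_nc_gamma_cdf:
  assumes N: "N \<ge> 1" and l: "l \<ge> 0" and b: "b \<ge> 0"
  shows "1 - marcum_Q N (sqrt (2 * l)) (sqrt (2 * b)) = nc_gamma_cdf N l b"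
proof -
  let ?p = "nc_gamma_density (real N) l"
  have m: "measure (density lborel ?p) {b..} = enn2real (\<integral>\<^sup>+s. ?p s * indicator {b..} s \<partial>lborel)"
    by (simp add: measure_def emeasure_density)
  have "marcum_Q N (sqrt (2 * l)) (sqrt (2 * b)) = measure (density lborel ?p) {b..}"
  proof (cases "l = 0")
    case True
    have "(\<integral>\<^sup>+s. ?p s * indicator {b..} s \<partial>lborel)
      = (\<integral>\<^sup>+s. ennreal (erlang_density (N - 1) 1 s) * indicator {b..} s \<partial>lborel)"
      unfolding nn_integral_nc_gamma_density[OF N, of "{b..}", simplified] True poisson_weight_def
      by (subst suminf_finite[of "{0}"]) (auto simp: emeasure_density)
    also have "\<dots> = (\<integral>\<^sup>+s. ennreal (indicator {b..} s * (s ^ (N - 1) * exp (- s)) / fact (N - 1)) \<partial>lborel)"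
      using b by (intro nn_integral_cong) (auto simp: erlang_density_def split: split_indicator)
    finally have "measure (density lborel ?p) {b..}
      = enn2real (\<integral>\<^sup>+s. ennreal (indicator {b..} s * (s ^ (N - 1) * exp (- s)) / fact (N - 1)) \<partial>lborel)"
      unfolding m by simp
    also have "\<dots> = (\<integral>s. indicator {b..} s * (s ^ (N - 1) * exp (- s)) / fact (N - 1) \<partial>lborel)"
      using b by (intro integral_eq_nn_integral[symmetric]) (auto split: split_indicator)
    also have "\<dots> = marcum_Q N (sqrt (2 * l)) (sqrt (2 * b))"
      using b True by (simp add: marcum_Q_def set_lebesgue_integral_def)
    finally show ?thesis ..
  next
    case False
    define a where "a = sqrt (2 * l)"
    have a: "a > 0" and l': "l = a\<^sup>2 / 2" using l False by (auto simp: a_def)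
    let ?q = "\<lambda>x. x * (x / a) ^ (N - 1) * exp (- (x\<^sup>2 + a\<^sup>2) / 2) * bessel_I (N - 1) (a * x)"
    have "(\<integral>\<^sup>+s. ?p s * indicator {b..} s \<partial>lborel)
      = (\<integral>\<^sup>+s. (?p s * indicator {b..} s) * indicator {0..} s \<partial>lborel)"
      using b by (intro nn_integral_cong) (auto split: split_indicator)
    also have "\<dots> = (\<integral>\<^sup>+x. (?p (1 / 2 * x\<^sup>2) * indicator {b..} (1 / 2 * x\<^sup>2)) * ennreal (2 * (1 / 2) * x) * indicator {0..} x \<partial>lborel)"
      by (rule nn_integral_square_substitution) auto
    also have "\<dots> = (\<integral>\<^sup>+x. ennreal (indicator {sqrt (2 * b)..} x * ?q x) \<partial>lborel)"
    proof (rule nn_integral_cong)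
      fix x :: real
      have "sqrt (2 * b) \<le> x \<longleftrightarrow> x \<ge> 0 \<and> b \<le> x\<^sup>2 / 2"
        using b real_sqrt_le_iff[of "2 * b" "x\<^sup>2"] order_trans[OF real_sqrt_ge_zero[of "2 * b"], of x]
        by (cases "x \<ge> 0") auto
      then show "(?p (1 / 2 * x\<^sup>2) * indicator {b..} (1 / 2 * x\<^sup>2)) * ennreal (2 * (1 / 2) * x) * indicator {0..} x
        = ennreal (indicator {sqrt (2 * b)..} x * ?q x)"
        using nc_gamma_density_bessel[OF N a, of x] unfolding l' by (auto split: split_indicator)
    qed
    finally have "measure (density lborel ?p) {b..} = enn2real (\<integral>\<^sup>+x. ennreal (indicator {sqrt (2 * b)..} x * ?q x) \<partial>lborel)"
      unfolding m by simp
    also have "\<dots> = (\<integral>x. indicator {sqrt (2 * b)..} x * ?q x \<partial>lborel)"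
    proof (intro integral_eq_nn_integral[symmetric] AE_I2)
      fix x :: real
      have "0 \<le> ?q x" if "x \<ge> 0"
        using a that by (intro mult_nonneg_nonneg bessel_I_nonneg zero_le_power) auto
      moreover have "x \<ge> 0" if "sqrt (2 * b) \<le> x"
        using b that order_trans[of 0 "sqrt (2 * b)" x] by simp
      ultimately show "0 \<le> indicator {sqrt (2 * b)..} x * ?q x"
        by (auto split: split_indicator)
    qed measurable
    also have "\<dots> = marcum_Q N (sqrt (2 * l)) (sqrt (2 * b))"
      using a by (simp add: marcum_Q_def set_lebesgue_integral_def a_def)
    finally show ?thesis ..
  qed
  then show ?thesis
    by (simp add: measure_nc_gamma_atLeast[OF N l])
qed

lemma (in prob_space) prob_less_nc_gamma:
  assumes X: "distributed M lborel X (nc_gamma_density (real N) l)" and "N \<ge> 1" "l \<ge> 0"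
  shows "prob {\<omega> \<in> space M. X \<omega> < b} = nc_gamma_cdf N l b"
proof -
  have [measurable]: "X \<in> borel_measurable M"
    using distributed_measurable[OF X] by simp
  interpret D: prob_space "density lborel (nc_gamma_density (real N) l)"
    using assms by (intro prob_space_nc_gamma)
  have "prob {\<omega> \<in> space M. X \<omega> < b} = measure (distr M lborel X) {..<b}"
    by (simp add: measure_distr vimage_def Int_def conj_commute)
  also have "\<dots> = D.prob {..<b}"
    by (simp add: distributed_distr_eq_density[OF X])
  also have "{..<b} = UNIV - {b..}"
    by auto
  also have "D.prob (UNIV - {b..}) = 1 - D.prob {b..}"
    using D.prob_compl[of "{b..}"] by simp
  also have "D.prob {b..} = 1 - nc_gamma_cdf N l b"
    by (rule measure_nc_gamma_atLeast) fact+
  finally show ?thesis by simp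
qed

section \<open>Lower bounds by conditioning\<close>

text \<open>By independence the joint law is a product measure, so the probability on the right is
  the integral of the section probabilities over the law of \<open>X\<close>, and each section over
  \<open>A\<close> has probability at least \<open>c\<close>.\<close>

lemma (in prob_space) indep_var_prob_ge:
  assumes ind: "indep_var S X T Y" and [measurable]: "A \<in> sets S" "B \<in> sets (S \<Otimes>\<^sub>M T)"
    and bound: "\<And>u. u \<in> A \<Longrightarrow> c \<le> prob {\<omega> \<in> space M. (u, Y \<omega>) \<in> B}"
  shows "prob {\<omega> \<in> space M. X \<omega> \<in> A} * c \<le> prob {\<omega> \<in> space M. X \<omega> \<in> A \<and> (X \<omega>, Y \<omega>) \<in> B}"
proof -
  have X [measurable]: "X \<in> measurable M S" and Y [measurable]: "Y \<in> measurable M T"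
    and D: "distr M S X \<Otimes>\<^sub>M distr M T Y = distr M (S \<Otimes>\<^sub>M T) (\<lambda>\<omega>. (X \<omega>, Y \<omega>))"
    using ind unfolding indep_var_distribution_eq by auto
  interpret Y: prob_space "distr M T Y" by (rule prob_space_distr) simp
  \<comment> \<open>Cutting down to \<open>A\<close> makes the event on the right a single set in
    the product space.\<close>
  define C where "C = B \<inter> (A \<times> space T)"
  have C [measurable]: "C \<in> sets (S \<Otimes>\<^sub>M T)"
    unfolding C_def by measurable
  have "ennreal (prob {\<omega> \<in> space M. X \<omega> \<in> A} * c) \<le> emeasure (distr M S X) A * ennreal c"
  proof -
    have "emeasure (distr M S X) A = ennreal (prob {\<omega> \<in> space M. X \<omega> \<in> A})"
      by (simp add: emeasure_distr emeasure_eq_measure vimage_def Int_def conj_commute)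
    then show ?thesis by (simp add: ennreal_mult')
  qed
  also have "\<dots> = (\<integral>\<^sup>+u. ennreal c * indicator A u \<partial>distr M S X)"
    by (simp add: nn_integral_cmult_indicator mult.commute)
  also have "\<dots> \<le> (\<integral>\<^sup>+u. emeasure (distr M T Y) (Pair u -` C) \<partial>distr M S X)"
  proof (rule nn_integral_mono)
    fix u assume "u \<in> space (distr M S X)"
    show "ennreal c * indicator A u \<le> emeasure (distr M T Y) (Pair u -` C)"
    proof (cases "u \<in> A")
      case True
      have "Pair u -` C \<in> sets T" by (rule sets_Pair1[OF C])
      then have "emeasure (distr M T Y) (Pair u -` C) = emeasure M (Y -` (Pair u -` C) \<inter> space M)"
        by (simp add: emeasure_distr)
      also have "Y -` (Pair u -` C) \<inter> space M = {\<omega> \<in> space M. (u, Y \<omega>) \<in> B}"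
        using True measurable_space[OF Y] by (auto simp: C_def)
      finally show ?thesis
        using True bound[OF True] by (simp add: emeasure_eq_measure ennreal_leI)
    qed simp
  qed
  also have "\<dots> = emeasure (distr M S X \<Otimes>\<^sub>M distr M T Y) C"
    by (rule Y.emeasure_pair_measure_alt[symmetric]) (simp add: C cong: sets_pair_measure_cong)
  also have "\<dots> = emeasure M {\<omega> \<in> space M. X \<omega> \<in> A \<and> (X \<omega>, Y \<omega>) \<in> B}"
    unfolding D using measurable_space[OF Y]
    by (subst emeasure_distr) (auto simp: C_def intro!: arg_cong[of _ _ "emeasure M"])
  finally show ?thesis
    by (simp add: emeasure_eq_measure)
qed

section \<open>Port gains as sums of shifted squares\<close>

text \<open>The Boolean index separates real from imaginary parts, so a row lists the
  \<open>2 * N\<close> real components of one port.\<close>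

lemma sum_row:
  "(\<Sum>i\<in>UNIV \<times> {m} \<times> {1..N}. f i) = (\<Sum>n = 1..N. f (False, m, n) + f (True, m, n))"
  for f :: "bool \<times> nat \<times> nat \<Rightarrow> real"
  by (simp add: sum.cartesian_product' UNIV_bool sum.distrib)

lemma port_gain_first:
  assumes "V = (\<lambda>(imag, m, n). if imag then y m n else x m n)"
  shows "port_gain N \<sigma> \<rho> x y 1 \<omega> = \<sigma>\<^sup>2 * (\<Sum>i\<in>UNIV \<times> {0} \<times> {1..N}. (V i \<omega>)\<^sup>2)"
  unfolding sum_row assms sum_distrib_left
  by (simp add: port_gain_def channel_def cmod_power2 power_mult_distrib algebra_simps)

text \<open>Taking \<open>sqrt (1 - \<rho>\<^sup>2)\<close> out of each component leaves a Gaussian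
  of unchanged variance, shifted by a multiple of the common component with the same part and the
  same \<open>n\<close>.\<close>

lemma port_gain_other:
  assumes V: "V = (\<lambda>(imag, m, n). if imag then y m n else x m n)"
    and "m \<noteq> 1" "\<bar>\<rho>\<bar> < 1"
  shows "port_gain N \<sigma> \<rho> x y m \<omega> = \<sigma>\<^sup>2 * (1 - \<rho>\<^sup>2) *
    (\<Sum>i\<in>UNIV \<times> {m} \<times> {1..N}. (V i \<omega> + \<rho> / sqrt (1 - \<rho>\<^sup>2) * V (fst i, 0, snd (snd i)) \<omega>)\<^sup>2)"
proof -
  have pos: "1 - \<rho>\<^sup>2 > 0" using assms by (simp add: abs_square_less_1)
  have *: "(\<sigma> * (sqrt (1 - \<rho>\<^sup>2) * z + \<rho> * u))\<^sup>2 = \<sigma>\<^sup>2 * (1 - \<rho>\<^sup>2) * (z + \<rho> / sqrt (1 - \<rho>\<^sup>2) * u)\<^sup>2" for z u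
  proof -
    have eq: "\<sigma> * (sqrt (1 - \<rho>\<^sup>2) * z + \<rho> * u) = \<sigma> * sqrt (1 - \<rho>\<^sup>2) * (z + \<rho> / sqrt (1 - \<rho>\<^sup>2) * u)"
      using pos by (simp add: distrib_left mult.assoc)
    show ?thesis unfolding eq using pos by (simp add: power_mult_distrib)
  qed
  have gain: "(cmod (channel \<sigma> \<rho> x y m n \<omega>))\<^sup>2 = (\<sigma> * (sqrt (1 - \<rho>\<^sup>2) * x m n \<omega> + \<rho> * x 0 n \<omega>))\<^sup>2
    + (\<sigma> * (sqrt (1 - \<rho>\<^sup>2) * y m n \<omega> + \<rho> * y 0 n \<omega>))\<^sup>2" for n
    using assms(2) by (simp add: channel_def cmod_power2)
  show ?thesis
    unfolding port_gain_def gain * sum_row V sum_distrib_left by (simp add: distrib_left)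
qed

text \<open>The \<open>2 * N\<close> squares of shape \<open>1 / 2\<close> add up to the integer
  shape \<open>N\<close>.\<close>

lemma (in prob_space) prob_row_sum_less:
  fixes V :: "bool \<times> nat \<times> nat \<Rightarrow> 'a \<Rightarrow> real"
  assumes ind: "indep_vars (\<lambda>_. borel) V (UNIV \<times> {m} \<times> {1..N})" and N: "N \<ge> 1"
    and V: "\<And>i. i \<in> UNIV \<times> {m} \<times> {1..N} \<Longrightarrow> distributed M lborel (V i) (normal_density 0 (sqrt (1 / 2)))"
  shows "prob {\<omega> \<in> space M. (\<Sum>i\<in>UNIV \<times> {m} \<times> {1..N}. (V i \<omega> + v i)\<^sup>2) < b}
    = nc_gamma_cdf N (\<Sum>i\<in>UNIV \<times> {m} \<times> {1..N}. (v i)\<^sup>2) b"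
proof (rule prob_less_nc_gamma)
  have "real (card ((UNIV :: bool set) \<times> {m} \<times> {1..N})) / 2 = real N"
    by (simp add: card_cartesian_product)
  then show "distributed M lborel (\<lambda>\<omega>. \<Sum>i\<in>UNIV \<times> {m} \<times> {1..N}. (V i \<omega> + v i)\<^sup>2)
    (nc_gamma_density (real N) (\<Sum>i\<in>UNIV \<times> {m} \<times> {1..N}. (v i)\<^sup>2))"
    using distributed_sum_shifted_normal_squares[OF _ _ ind V, of v] N by simp
qed (use N in \<open>auto intro: sum_nonneg\<close>)

section \<open>The outage bound\<close>

theorem corollary2:
  fixes P :: "'a measure"
    and N M :: nat
    and \<sigma> \<rho> :: real
    and x y :: "nat \<Rightarrow> nat \<Rightarrow> 'a \<Rightarrow> real"
    and \<gamma>th :: real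
  assumes "prob_space P"
    and "N \<ge> 1" and "M \<ge> 1"
    and "\<sigma> > 0" and "\<bar>\<rho>\<bar> < 1"
    and indep: "prob_space.indep_vars P (\<lambda>_. borel)
      (\<lambda>(imag :: bool, m, n). if imag then y m n else x m n)
      (UNIV \<times> ({0} \<union> {2..M}) \<times> {1..N})"
    and gauss_x: "\<And>m n. m \<in> {0} \<union> {2..M} \<Longrightarrow> n \<in> {1..N} \<Longrightarrow>
      distributed P lborel (x m n) (normal_density 0 (sqrt (1 / 2)))"
    and gauss_y: "\<And>m n. m \<in> {0} \<union> {2..M} \<Longrightarrow> n \<in> {1..N} \<Longrightarrow>
      distributed P lborel (y m n) (normal_density 0 (sqrt (1 / 2)))"
    and "\<gamma>th > 0"
  shows "P_out P N M \<sigma> \<rho> x y \<gamma>th \<ge>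
    1 / fact (N - 1) * lower_inc_gamma N (\<gamma>th / \<sigma>\<^sup>2) *
    (1 - marcum_Q N (sqrt (2 * \<rho>\<^sup>2 * \<gamma>th / (\<sigma>\<^sup>2 * (1 - \<rho>\<^sup>2))))
                    (sqrt (2 * \<gamma>th / (\<sigma>\<^sup>2 * (1 - \<rho>\<^sup>2))))) ^ (M - 1)"
proof -
  interpret prob_space P by fact
  define V where "V = (\<lambda>(imag :: bool, m, n). if imag then y m n else x m n)"
  define row where "row m = (UNIV :: bool set) \<times> {m :: nat} \<times> {1..N}" for m
  define rows where "rows = (UNIV :: bool set) \<times> {2..M} \<times> {1..N}"
  \<comment> \<open>Normalized quantities: \<open>r\<close> multiplies the common component in the
    shift, \<open>t\<close> is the threshold for the squared norm of the common vector, and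
    \<open>b\<close> is the threshold for the normalized gains of the other ports.\<close>
  define r where "r = \<rho> / sqrt (1 - \<rho>\<^sup>2)"
  define t where "t = \<gamma>th / \<sigma>\<^sup>2"
  define b where "b = t / (1 - \<rho>\<^sup>2)"
  have \<rho>: "1 - \<rho>\<^sup>2 > 0" using \<open>\<bar>\<rho>\<bar> < 1\<close> by (simp add: abs_square_less_1)
  have t: "t > 0" and b: "b > 0" using assms \<rho> by (auto simp: t_def b_def)
  have r2: "r\<^sup>2 = \<rho>\<^sup>2 / (1 - \<rho>\<^sup>2)" using \<rho> by (simp add: r_def power_divide)
  \<comment> \<open>The conditional probability for one further port when the squared norm of the
    common vector equals \<open>t\<close>, that is, with noncentrality
    \<open>r\<^sup>2 * t\<close>.\<close>
  define F where "F = nc_gamma_cdf N (r\<^sup>2 * t) b"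
  have F: "0 \<le> F" unfolding F_def using t by (intro nc_gamma_cdf_nonneg) simp
  have sub: "row 0 \<subseteq> UNIV \<times> ({0} \<union> {2..M}) \<times> {1..N}" "rows \<subseteq> UNIV \<times> ({0} \<union> {2..M}) \<times> {1..N}"
    "m \<in> {2..M} \<Longrightarrow> row m \<subseteq> UNIV \<times> ({0} \<union> {2..M}) \<times> {1..N}"
    "m \<in> {2..M} \<Longrightarrow> row m \<subseteq> rows" "row 0 \<inter> rows = {}" for m
    by (auto simp: row_def rows_def)
  note indV = indep[folded V_def]
  have gauss: "distributed P lborel (V i) (normal_density 0 (sqrt (1 / 2)))"
    if "i \<in> UNIV \<times> ({0} \<union> {2..M}) \<times> {1..N}" for i
    using that gauss_x gauss_y by (auto simp: V_def)
  have row_prob: "prob {\<omega> \<in> space P. (\<Sum>i\<in>row m. (V i \<omega> + v i)\<^sup>2) < s} = nc_gamma_cdf N (\<Sum>i\<in>row m. (v i)\<^sup>2) s"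
    if "m = 0 \<or> m \<in> {2..M}" for m v s
    unfolding row_def
    using that sub(1) sub(3)[of m] \<open>N \<ge> 1\<close>
    by (intro prob_row_sum_less indep_vars_subset[OF indV] gauss) (auto simp: row_def)

  define A where "A = {u \<in> space (PiM (row 0) (\<lambda>_. borel :: real measure)). (\<Sum>i\<in>row 0. (u i)\<^sup>2) < t}"
  define base where "base i = (fst i, 0 :: nat, snd (snd i))" for i :: "bool \<times> nat \<times> nat"
  \<comment> \<open>The normalized gain of port \<open>m\<close> as a function of the common vector
    \<open>u\<close> and the private components \<open>z\<close>.\<close>
  define T where "T m u z = (\<Sum>i\<in>row m. (z i + r * u (base i))\<^sup>2)"
    for m and u z :: "bool \<times> nat \<times> nat \<Rightarrow> real"
  define S where "S = PiM (row 0) (\<lambda>_. borel :: real measure)"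
  define S' where "S' = PiM rows (\<lambda>_. borel :: real measure)"
  define B where "B = {p \<in> space (S \<Otimes>\<^sub>M S'). \<forall>m\<in>{2..M}. T m (fst p) (snd p) < b}"
  define X where "X \<omega> = restrict (\<lambda>i. V i \<omega>) (row 0)" for \<omega>
  define Y where "Y \<omega> = restrict (\<lambda>i. V i \<omega>) rows" for \<omega>
  have base: "i \<in> row m \<Longrightarrow> base i \<in> row 0" for i m
    by (auto simp: row_def base_def)
  have sum_base: "(\<Sum>i\<in>row m. f (base i)) = (\<Sum>i\<in>row 0. f i)" for m and f :: "_ \<Rightarrow> real"
    unfolding row_def sum_row by (simp add: base_def)
  have ind: "indep_var S X S' Y"
    unfolding S_def S'_def X_def Y_def using sub by (intro indep_var_restrict[OF indV])
  then have X [measurable]: "X \<in> measurable P S" and Y [measurable]: "Y \<in> measurable P S'"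
    by (auto dest: indep_var_rv1 indep_var_rv2)
  have [measurable]: "A \<in> sets S"
    unfolding A_def S_def by measurable
  have [measurable]: "B \<in> sets (S \<Otimes>\<^sub>M S')"
  proof -
    have "(\<lambda>p. T m (fst p) (snd p)) \<in> borel_measurable (S \<Otimes>\<^sub>M S')" if "m \<in> {2..M}" for m
      unfolding T_def
    proof (intro borel_measurable_sum borel_measurable_power borel_measurable_add borel_measurable_times borel_measurable_const)
      fix i assume i: "i \<in> row m"
      show "(\<lambda>p. snd p i) \<in> borel_measurable (S \<Otimes>\<^sub>M S')"
        unfolding S'_def using sub(4)[OF that] i
        by (intro measurable_compose[OF measurable_snd measurable_component_singleton]) auto
      show "(\<lambda>p. fst p (base i)) \<in> borel_measurable (S \<Otimes>\<^sub>M S')"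
        unfolding S_def using base[OF i]
        by (intro measurable_compose[OF measurable_fst measurable_component_singleton])
    qed
    then show ?thesis unfolding B_def by measurable
  qed

  \<comment> \<open>With the common vector frozen at \<open>u\<close>, the remaining gains are
    independent, and each factor of the product is at least \<open>F\<close>.\<close>
  have cond: "F ^ (M - 1) \<le> prob {\<omega> \<in> space P. (u, Y \<omega>) \<in> B}" if u: "u \<in> A" for u
  proof -
    define G where "G m \<omega> = (\<Sum>i\<in>row m. (V i \<omega> + r * u (base i))\<^sup>2)" for m \<omega>
    have TG: "T m u (Y \<omega>) = G m \<omega>" if "m \<in> {2..M}" for m \<omega>
      unfolding T_def G_def Y_def using sub(4)[OF that] by (intro sum.cong refl) auto
    have "u \<in> space S" using u by (simp add: A_def S_def)
    then have eq: "{\<omega> \<in> space P. (u, Y \<omega>) \<in> B} = {\<omega> \<in> space P. \<forall>m\<in>{2..M}. G m \<omega> < b}"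
      using measurable_space[OF Y] by (auto simp: B_def space_pair_measure TG)
    show ?thesis
    \<comment> \<open>Without further ports both sides are \<open>1\<close>; the product formula for
      independent variables is applied to a nonempty index set only.\<close>
    proof (cases "M = 1")
      case True
      then show ?thesis unfolding eq by (simp add: prob_space)
    next
      case False
      with \<open>M \<ge> 1\<close> have ne: "{2..M} \<noteq> {}" by simp
      \<comment> \<open>Disjoint rows form independent blocks, and for fixed \<open>u\<close> each
        \<open>G m\<close> is a function of its own block.\<close>
      have "indep_vars (\<lambda>m. PiM (row m) (\<lambda>_. borel)) (\<lambda>m \<omega>. restrict (\<lambda>i. V i \<omega>) (row m)) {2..M}"
        using sub(3) by (intro indep_vars_restrict[OF indV]) (auto simp: disjoint_family_on_def row_def)
      then have "indep_vars (\<lambda>_. borel) (\<lambda>m \<omega>. \<Sum>i\<in>row m. (restrict (\<lambda>i. V i \<omega>) (row m) i + r * u (base i))\<^sup>2) {2..M}"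
        by (rule indep_vars_compose2[where Y = "\<lambda>m z. \<Sum>i\<in>row m. (z i + r * u (base i))\<^sup>2"]) measurable
      then have indG: "indep_vars (\<lambda>_. borel) G {2..M}"
        by (simp add: G_def[abs_def] cong: sum.cong)
      have "F ^ (M - 1) = (\<Prod>m\<in>{2..M}. F)"
        by simp
      also have "\<dots> \<le> (\<Prod>m\<in>{2..M}. prob {\<omega> \<in> space P. G m \<omega> < b})"
      proof (intro prod_mono conjI F)
        fix m assume m: "m \<in> {2..M}"
        \<comment> \<open>The noncentrality of port \<open>m\<close> given \<open>u\<close> is at
          most the boundary value, since \<open>u \<in> A\<close> keeps the squared norm below
          \<open>t\<close>.\<close>
        have "(\<Sum>i\<in>row m. (r * u (base i))\<^sup>2) = r\<^sup>2 * (\<Sum>i\<in>row 0. (u i)\<^sup>2)"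
          unfolding sum_base[of "\<lambda>i. (r * u i)\<^sup>2"] by (simp add: power_mult_distrib sum_distrib_left)
        also have "\<dots> \<le> r\<^sup>2 * t"
          using u by (intro mult_left_mono) (auto simp: A_def)
        finally show "F \<le> prob {\<omega> \<in> space P. G m \<omega> < b}"
          unfolding F_def G_def using m by (subst row_prob) (auto intro!: nc_gamma_cdf_antimono sum_nonneg)
      qed
      also have "\<dots> = prob (\<Inter>m\<in>{2..M}. G m -` {..<b} \<inter> space P)"
        by (subst indep_varsD_finite[OF indG ne]) (auto intro!: prod.cong arg_cong[of _ _ prob])
      also have "(\<Inter>m\<in>{2..M}. G m -` {..<b} \<inter> space P) = {\<omega> \<in> space P. (u, Y \<omega>) \<in> B}"
        unfolding eq using ne by auto
      finally show ?thesis .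
    qed
  qed

  have XA: "X \<omega> \<in> A \<longleftrightarrow> (\<Sum>i\<in>row 0. (V i \<omega>)\<^sup>2) < t" for \<omega>
    by (simp add: A_def X_def space_PiM)
  \<comment> \<open>A finite maximum lies below the threshold exactly when all gains do: port
    \<open>1\<close> depends on the common vector alone and yields \<open>A\<close>, the other ports
    yield \<open>B\<close>.\<close>
  have gains: "X_FAS N M \<sigma> \<rho> x y \<omega> < \<gamma>th \<longleftrightarrow> X \<omega> \<in> A \<and> (X \<omega>, Y \<omega>) \<in> B" if \<omega>: "\<omega> \<in> space P" for \<omega>
  proof -
    have "port_gain N \<sigma> \<rho> x y 1 \<omega> < \<gamma>th \<longleftrightarrow> X \<omega> \<in> A"
      using \<open>\<sigma> > 0\<close> unfolding XA port_gain_first[OF V_def] row_def t_def by (simp add: field_simps)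
    moreover have "port_gain N \<sigma> \<rho> x y m \<omega> < \<gamma>th \<longleftrightarrow> T m (X \<omega>) (Y \<omega>) < b" if m: "m \<in> {2..M}" for m
    proof -
      have "T m (X \<omega>) (Y \<omega>) = (\<Sum>i\<in>row m. (V i \<omega> + r * V (base i) \<omega>)\<^sup>2)"
        unfolding T_def X_def Y_def using sub(4)[OF m] base by (intro sum.cong refl) auto
      moreover have "m \<noteq> 1" using m by simp
      ultimately have "port_gain N \<sigma> \<rho> x y m \<omega> = \<sigma>\<^sup>2 * (1 - \<rho>\<^sup>2) * T m (X \<omega>) (Y \<omega>)"
        using port_gain_other[OF V_def _ \<open>\<bar>\<rho>\<bar> < 1\<close>, of m] by (simp add: row_def r_def base_def)
      moreover have "\<gamma>th = \<sigma>\<^sup>2 * (1 - \<rho>\<^sup>2) * b"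
        using \<open>\<sigma> > 0\<close> \<rho> by (simp add: b_def t_def)
      moreover have "\<sigma>\<^sup>2 * (1 - \<rho>\<^sup>2) > 0"
        using \<open>\<sigma> > 0\<close> \<rho> by simp
      ultimately show ?thesis
        by (simp only: mult_less_cancel_left_pos)
    qed
    moreover have "(X \<omega>, Y \<omega>) \<in> space (S \<Otimes>\<^sub>M S')"
      using measurable_space[OF X \<omega>] measurable_space[OF Y \<omega>] by (simp add: space_pair_measure)
    moreover have "{1..M} = insert 1 {2..M}" using \<open>M \<ge> 1\<close> by auto
    ultimately show ?thesis
      by (simp add: X_FAS_def B_def)
  qed

  have "1 / fact (N - 1) * lower_inc_gamma N t * F ^ (M - 1) = prob {\<omega> \<in> space P. X \<omega> \<in> A} * F ^ (M - 1)"
    unfolding XA using row_prob[of 0 "\<lambda>_. 0" t] t \<open>N \<ge> 1\<close> by (simp add: nc_gamma_cdf_zero_noncentrality)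
  also have "\<dots> \<le> prob {\<omega> \<in> space P. X \<omega> \<in> A \<and> (X \<omega>, Y \<omega>) \<in> B}"
    by (rule indep_var_prob_ge[OF ind _ _ cond]) measurable
  also have "\<dots> = P_out P N M \<sigma> \<rho> x y \<gamma>th"
    unfolding P_out_def using gains by (intro arg_cong[of _ _ prob]) auto
  finally have "1 / fact (N - 1) * lower_inc_gamma N t * F ^ (M - 1) \<le> P_out P N M \<sigma> \<rho> x y \<gamma>th" .
  moreover have "F = 1 - marcum_Q N (sqrt (2 * (r\<^sup>2 * t))) (sqrt (2 * b))"
    unfolding F_def using \<open>N \<ge> 1\<close> t b by (intro marcum_Q_eq_nc_gamma_cdf[symmetric]) auto
  \<comment> \<open>The squares of the two Marcum arguments are \<open>2 * (r\<^sup>2 * t)\<close>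
    and \<open>2 * b\<close>.\<close>
  moreover have "2 * (r\<^sup>2 * t) = 2 * \<rho>\<^sup>2 * \<gamma>th / (\<sigma>\<^sup>2 * (1 - \<rho>\<^sup>2))" "2 * b = 2 * \<gamma>th / (\<sigma>\<^sup>2 * (1 - \<rho>\<^sup>2))"
    unfolding r2 b_def t_def by (simp_all add: mult.commute)
  ultimately show ?thesis by (simp add: t_def)
qed

end
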